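(* The set $\operatorname{Sort}(\operatorname{SC}_{12})$ is equal to the permutation class $\operatorname{Av}(213)$, while $\operatorname{Sort}(\operatorname{SC}_{21})$ is not a permutation class. If $\sigma\in S_k$ for some $k\geq 3$, then $\operatorname{Sort}(\operatorname{SC}_\sigma)$ is a permutation class if and only if both $\sigma$ and $\widehat\sigma$ contain the pattern $231$ classically; in this case $\operatorname{Sort}(\operatorname{SC}_\sigma)=\operatorname{Av}(132)$.
   Context: $S_n$ is the set of permutations of $[n]=\{1,\dots,n\}$, written in one-line notation. Two sequences of distinct integers have the same relative order if replacing the $i$th smallest entry of each by $i$ yields the same word. A permutation $\tau$ contains $\sigma$ classically if some (not necessarily consecutive) subsequence of $\tau$ has the same relative order as $\sigma$, and contains $\sigma$ consecutively if some consecutive subsequence does; otherwise $\tau$ avoids $\sigma$ classically/consecutively. $\operatorname{Av}(\tau^{(1)},\dots)$ denotes the set of all permutations (of all lengths $n\ge 0$) avoiding the listed patterns classically. For a set $\mathcal A$ of permutations, the map $T_{\mathcal A}:S_n\to S_n$ is defined as follows: send $\pi=\pi_1\cdots\pi_n$ through a stack; at each step, if there is a next input entry and placing it on top of the stack would make the stack contents, read from top to bottom, have the same relative order as some element of $\mathcal A$, push it; otherwise pop the top entry of the stack and append it to the end of the output. Stop when the output has length $n$; $T_{\mathcal A}(\pi)$ is the output. For a permutation $\sigma$, $\operatorname{SC}_\sigma=T_{\mathcal A}$ where $\mathcal A$ is the set of permutations avoiding $\sigma$ consecutively. $\operatorname{Sort}(\operatorname{SC}_\sigma)=\operatorname{SC}_\sigma^{-1}(\operatorname{Av}(231))$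 is the set of permutations $\pi$ (of any length) such that $\operatorname{SC}_\sigma(\pi)$ avoids $231$ classically. For $\sigma=\sigma_1\sigma_2\sigma_3\cdots\sigma_k$, $\widehat\sigma=\sigma_2\sigma_1\sigma_3\cdots\sigma_k$. A permutation class is a set of permutations closed under classical pattern containment (if $\sigma$ is in the set and $\sigma$ contains $\tau$ classically then $\tau$ is in the set). *)

theory Defs
  imports "HOL-Combinatorics.Multiset_Permutations" "HOL-Library.Sublist"
begin

definition Sym :: "nat \<Rightarrow> nat list set" where
  "Sym n = permutations_of_set {1..n}"

definition perms :: "nat list set" where
  "perms = (\<Union>n. Sym n)"

(* For a list of distinct entries, the i-th smallest entry is the one with exactly i entries below
   or equal to it. *)
definition standardize :: "nat list \<Rightarrow> nat list" where
  "standardize xs = map (\<lambda>x. card {y \<in> set xs. y \<le> x}) xs"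

definition same_order :: "nat list \<Rightarrow> nat list \<Rightarrow> bool" where
  "same_order xs ys \<longleftrightarrow> standardize xs = standardize ys"

definition contains :: "nat list \<Rightarrow> nat list \<Rightarrow> bool" where
  "contains \<tau> \<sigma> \<longleftrightarrow> (\<exists>zs. subseq zs \<tau> \<and> same_order zs \<sigma>)"

definition contains_consec :: "nat list \<Rightarrow> nat list \<Rightarrow> bool" where
  "contains_consec \<tau> \<sigma> \<longleftrightarrow> (\<exists>zs. sublist zs \<tau> \<and> same_order zs \<sigma>)"

definition Av :: "nat list set \<Rightarrow> nat list set" where
  "Av P = {\<pi> \<in> perms. \<forall>\<sigma>\<in>P. \<not> contains \<pi> \<sigma>}"

definition perm_class :: "nat list set \<Rightarrow> bool" where
  "perm_class C \<longleftrightarrow>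
     C \<subseteq> perms \<and> (\<forall>\<sigma>\<in>C. \<forall>\<tau>\<in>perms. contains \<sigma> \<tau> \<longrightarrow> \<tau> \<in> C)"

(* stack_run A input stack: the entries still to be output from this configuration; the head of the
   stack list is the top of the stack. If the stack is empty and the next entry may not be pushed,
   the procedure is undefined; this cannot happen when A contains the permutation [1], as it does
   for every map SC s with s of length at least 2, and the value [] is then arbitrary. *)
function stack_run :: "nat list set \<Rightarrow> nat list \<Rightarrow> nat list \<Rightarrow> nat list" where
  "stack_run A [] [] = []"
| "stack_run A [] (s # st) = s # stack_run A [] st"
| "stack_run A (x # inp) st =
     (if \<exists>\<tau>\<in>A. same_order (x # st) \<tau> then stack_run A inp (x # st)
      else (case st of [] \<Rightarrow> [] | s # st' \<Rightarrow> s # stack_run A (x # inp) st'))"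
  by pat_completeness auto
termination
  by (relation "measure (\<lambda>(A, inp, st). 2 * length inp + length st)") auto

definition T :: "nat list set \<Rightarrow> nat list \<Rightarrow> nat list" where
  "T A \<pi> = stack_run A \<pi> []"

definition SC :: "nat list \<Rightarrow> nat list \<Rightarrow> nat list" where
  "SC \<sigma> = T {\<tau> \<in> perms. \<not> contains_consec \<tau> \<sigma>}"

definition Sort :: "(nat list \<Rightarrow> nat list) \<Rightarrow> nat list set" where
  "Sort f = {\<pi> \<in> perms. f \<pi> \<in> Av {[2, 3, 1]}}"

fun swap_first_two :: "nat list \<Rightarrow> nat list" where
  "swap_first_two (a # b # xs) = b # a # xs"
| "swap_first_two xs = xs"

end

theory Submission
  imports Defs
begin

text \<open>If the stack never refuses an entry, the output is the reverse of the input. Otherwise, at the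
  last pop before a refused entry is pushed, the popped entry, the refused one and the entries below
  them leave the stack in an order that forms \<open>\<sigma>\<close> with its first two entries swapped. Hence the
  output avoids 231 precisely when the input avoids 132, provided both \<open>\<sigma>\<close> and its swapped version
  contain 231. In all other cases a sortable word with an unsortable pattern is exhibited; for
  \<open>k \<ge> 3\<close> the word is the reverse of \<open>\<sigma>\<close> with at most two entries inserted, and the pattern is 132
  or the reverse of \<open>\<sigma>\<close> with at most one entry inserted.

  For \<open>\<sigma> = 12\<close> an entry \<open>m\<close> smaller than all others empties the stack and then stays at its bottom.
  So \<open>L m R\<close> is mapped to the images of \<open>L\<close> and \<open>R\<close> followed by \<open>m\<close>, and by induction the
  output is decreasing if and only if the input avoids 213.\<close>

section \<open>Relative order\<close>

lemma standardize_map: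
  assumes "strict_mono_on (set xs) f"
  shows "standardize (map f xs) = standardize xs"
proof -
  have "card {y \<in> f ` set xs. y \<le> f x} = card {y \<in> set xs. y \<le> x}" if x: "x \<in> set xs" for x
  proof -
    have "{y \<in> f ` set xs. y \<le> f x} = f ` {y \<in> set xs. y \<le> x}"
      using strict_mono_on_less_eq[OF assms] x by auto
    moreover have "inj_on f {y \<in> set xs. y \<le> x}"
      using strict_mono_on_imp_inj_on[OF assms] by (rule inj_on_subset) auto
    ultimately show ?thesis by (simp add: card_image)
  qed
  then show ?thesis by (simp add: standardize_def)
qed

lemma standardize_eq_strict_mono_map:
  obtains f where "strict_mono_on (set xs) f" "standardize xs = map f xs"
proof
  show "strict_mono_on (set xs) (\<lambda>x. card {y \<in> set xs. y \<le> x})"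
    by (rule strict_mono_onI, rule psubset_card_mono) force+
qed (simp add: standardize_def)

lemma same_order_refl [simp]: "same_order xs xs"
  by (simp add: same_order_def)

lemma same_order_sym: "same_order xs ys \<Longrightarrow> same_order ys xs"
  by (simp add: same_order_def)

lemma same_order_trans: "same_order xs ys \<Longrightarrow> same_order ys zs \<Longrightarrow> same_order xs zs"
  by (simp add: same_order_def)

lemma same_order_length: "same_order xs ys \<Longrightarrow> length xs = length ys"
  by (metis same_order_def standardize_def length_map)

lemma same_order_map:
  assumes "strict_mono_on A f" "set xs \<subseteq> A"
  shows "same_order (map f xs) xs"
  using monotone_on_subset[OF assms] by (simp add: same_order_def standardize_map)

lemma same_order_standardize: "same_order (standardize xs) xs"
  by (metis order_refl same_order_map standardize_eq_strict_mono_map)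

lemma same_order_iff_map:
  "same_order xs ys \<longleftrightarrow> (\<exists>f. strict_mono_on (set xs) f \<and> ys = map f xs)"
proof
  assume so: "same_order xs ys"
  obtain g where g: "strict_mono_on (set xs) g" "standardize xs = map g xs"
    by (rule standardize_eq_strict_mono_map)
  obtain h where h: "strict_mono_on (set ys) h" "standardize ys = map h ys"
    by (rule standardize_eq_strict_mono_map)
  have maps_eq: "map g xs = map h ys" using so g(2) h(2) by (simp add: same_order_def)
  define f where "f = inv_into (set ys) h \<circ> g"
  have "g x \<in> h ` set ys" if "x \<in> set xs" for x
    using that arg_cong[OF maps_eq, of set] by auto
  then have f_into: "f x \<in> set ys" and hf: "h (f x) = g x" if "x \<in> set xs" for x
    using that by (simp_all add: f_def inv_into_into f_inv_into_f)
  have "strict_mono_on (set xs) f"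
    by (rule strict_mono_onI)
      (metis f_into hf strict_mono_onD[OF g(1)] strict_mono_on_less[OF h(1)])
  moreover have "map f xs = ys"
    using strict_mono_on_imp_inj_on[OF h(1)] maps_eq
    by (simp add: f_def flip: map_map) (simp add: map_idI)
  ultimately show "\<exists>f. strict_mono_on (set xs) f \<and> ys = map f xs" by blast
qed (auto intro: same_order_map same_order_sym)

lemma same_order_iff_nth:
  "same_order xs ys \<longleftrightarrow> length xs = length ys \<and>
     (\<forall>i<length xs. \<forall>j<length xs. xs ! i < xs ! j \<longleftrightarrow> ys ! i < ys ! j)"
proof
  assume "same_order xs ys"
  then obtain f where "strict_mono_on (set xs) f" "ys = map f xs"
    by (auto simp: same_order_iff_map)
  then show "length xs = length ys \<and>
      (\<forall>i<length xs. \<forall>j<length xs. xs ! i < xs ! j \<longleftrightarrow> ys ! i < ys ! j)"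
    by (auto simp: strict_mono_on_less)
next
  assume same: "length xs = length ys \<and>
      (\<forall>i<length xs. \<forall>j<length xs. xs ! i < xs ! j \<longleftrightarrow> ys ! i < ys ! j)"
  have "\<exists>y. \<forall>i<length xs. xs ! i = x \<longrightarrow> ys ! i = y" for x
    using same by (metis nat_neq_iff)
  then obtain f where f: "\<And>i. i < length xs \<Longrightarrow> f (xs ! i) = ys ! i" by metis
  have "strict_mono_on (set xs) f"
    using same f by (intro strict_mono_onI) (metis in_set_conv_nth)
  moreover have "ys = map f xs" using same f by (intro nth_equalityI) auto
  ultimately show "same_order xs ys" unfolding same_order_iff_map by blast
qed

lemma same_order_Nil [simp]: "same_order [] ys \<longleftrightarrow> ys = []" "same_order xs [] \<longleftrightarrow> xs = []"
  by (auto simp: same_order_iff_nth)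

lemma same_order_Cons [simp]:
  "same_order (x # xs) (y # ys) \<longleftrightarrow>
     list_all2 (\<lambda>a b. (x < a \<longleftrightarrow> y < b) \<and> (a < x \<longleftrightarrow> b < y)) xs ys \<and> same_order xs ys"
  by (auto simp: same_order_iff_nth list_all2_conv_all_nth All_less_Suc2)

lemma same_order_rev:
  assumes "same_order xs ys"
  shows "same_order (rev xs) (rev ys)"
  using assms by (auto simp: same_order_iff_nth rev_nth)

lemma same_order_distinct_iff:
  assumes "same_order xs ys"
  shows "distinct xs \<longleftrightarrow> distinct ys"
proof -
  obtain f where "strict_mono_on (set xs) f" "ys = map f xs"
    using assms by (auto simp: same_order_iff_map)
  then show ?thesis using strict_mono_on_imp_inj_on by (auto simp: distinct_map)
qed

lemma standardize_in_perms:
  assumes "distinct xs"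
  shows "standardize xs \<in> perms"
proof -
  have distinct: "distinct (standardize xs)"
    using assms same_order_distinct_iff[OF same_order_standardize] by blast
  have "c \<in> {1..length xs}" if "c \<in> set (standardize xs)" for c
  proof -
    obtain x where x: "x \<in> set xs" "c = card {y \<in> set xs. y \<le> x}"
      using \<open>c \<in> set (standardize xs)\<close> by (auto simp: standardize_def)
    have "0 < c" using x by (auto simp: card_gt_0_iff)
    moreover have "c \<le> card (set xs)" unfolding x(2) by (rule card_mono) auto
    ultimately show ?thesis using card_length[of xs] by auto
  qed
  moreover have "card (set (standardize xs)) = length xs"
    using distinct_card[OF distinct] by (simp add: standardize_def)
  ultimately have "set (standardize xs) = {1..length xs}"
    by (intro card_subset_eq) auto
  then show ?thesis
    using distinct unfolding perms_def Sym_def permutations_of_set_def by blast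
qed

lemma Sym_D:
  assumes "\<sigma> \<in> Sym k"
  shows "distinct \<sigma>" "length \<sigma> = k"
  using assms by (auto simp: Sym_def permutations_of_set_def dest: distinct_card)

lemma perms_distinct: "\<pi> \<in> perms \<Longrightarrow> distinct \<pi>"
  by (auto simp: perms_def dest: Sym_D)

lemma perms_mset_cong: "mset \<pi> = mset \<rho> \<Longrightarrow> \<pi> \<in> perms \<longleftrightarrow> \<rho> \<in> perms"
  unfolding perms_def Sym_def permutations_of_set_def
  by simp (metis mset_eq_imp_distinct_iff mset_eq_setD)

section \<open>Pattern containment\<close>

lemma set_subseq: "subseq xs ys \<Longrightarrow> set xs \<subseteq> set ys"
  by (auto dest: list_emb_set)

lemma subseq_rev:
  assumes "subseq xs ys"
  shows "subseq (rev xs) (rev ys)"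
  using assms
proof (induction rule: list_emb.induct)
  case (list_emb_Cons2 x y xs ys)
  then show ?case by (simp add: list_emb_append_mono)
qed auto

lemma sorted_wrt_iff_subseq: "sorted_wrt P xs \<longleftrightarrow> (\<forall>x y. subseq [x, y] xs \<longrightarrow> P x y)"
proof (induction xs)
  case (Cons z xs)
  have "subseq [x, y] (z # xs) \<longleftrightarrow> x = z \<and> y \<in> set xs \<or> subseq [x, y] xs" for x y
    using subseq_Cons'[of x "[y]" xs] by (auto simp: subseq_singleton_left)
  then show ?case using Cons.IH by auto
qed simp

lemma contains_refl: "contains xs xs"
  using contains_def by auto

lemma contains_Nil [simp]: "contains [] p \<longleftrightarrow> p = []"
  by (auto simp: contains_def dest: list_emb_Nil2)

lemma subseq_imp_contains: "subseq xs ys \<Longrightarrow> contains ys xs"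
  using contains_def by auto

lemma same_order_imp_contains: "same_order p xs \<Longrightarrow> contains xs p"
  using contains_def same_order_sym by blast

lemma contains_subseq: "contains xs p \<Longrightarrow> subseq xs ys \<Longrightarrow> contains ys p"
  unfolding contains_def by (meson subseq_order.order_trans)

lemma contains_cong:
  assumes "same_order xs ys" "same_order p q"
  shows "contains xs p \<longleftrightarrow> contains ys q"
proof -
  have "contains vs q'" if so: "same_order us vs" "same_order p' q'" and c: "contains us p'"
    for us vs p' q'
  proof -
    obtain f where f: "strict_mono_on (set us) f" "vs = map f us"
      using so(1) by (auto simp: same_order_iff_map)
    obtain zs where zs: "subseq zs us" "same_order zs p'" using c by (auto simp: contains_def)
    have "same_order (map f zs) zs" using f(1) set_subseq[OF zs(1)] by (rule same_order_map)
    then show ?thesis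
      unfolding contains_def f(2) using zs so(2) same_order_trans subseq_map by blast
  qed
  then show ?thesis using assms same_order_sym by blast
qed

lemma contains_trans: "contains xs ys \<Longrightarrow> contains ys zs \<Longrightarrow> contains xs zs"
  using contains_def contains_cong[OF _ same_order_refl] contains_subseq by blast

lemma contains_distinct: "contains xs p \<Longrightarrow> distinct xs \<Longrightarrow> distinct p"
  by (metis contains_def distinct_nthsI same_order_distinct_iff subseq_conv_nths)

lemma contains_rev: "contains (rev xs) (rev p) \<longleftrightarrow> contains xs p"
proof -
  have "contains (rev ys) (rev q)" if "contains ys q" for ys q
    using that unfolding contains_def using same_order_rev subseq_rev by blast
  from this[of xs p] this[of "rev xs" "rev p"] show ?thesis by auto
qed

lemma contains_rev_132: "contains (rev w) [1, 3, 2] \<longleftrightarrow> contains w [2, 3, 1]"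
  using contains_rev[of w "[2, 3, 1]"] by simp

lemma contains_triple_iff:
  "contains w [p, q, r] \<longleftrightarrow> (\<exists>x y z. subseq [x, y, z] w \<and> same_order [x, y, z] [p, q, r])"
proof
  assume "contains w [p, q, r]"
  then obtain zs where zs: "subseq zs w" "same_order zs [p, q, r]" by (auto simp: contains_def)
  from same_order_length[OF zs(2)] obtain x y z where "zs = [x, y, z]"
    by (auto simp: length_Suc_conv)
  with zs show "\<exists>x y z. subseq [x, y, z] w \<and> same_order [x, y, z] [p, q, r]" by blast
qed (auto simp: contains_def)

lemma contains_231_iff: "contains w [2, 3, 1] \<longleftrightarrow> (\<exists>a b c. subseq [b, c, a] w \<and> a < b \<and> b < c)"
proof -
  have "same_order [b, c, a] [2, 3, 1] \<longleftrightarrow> a < b \<and> b < c" for a b c by auto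
  then show ?thesis unfolding contains_triple_iff by metis
qed

lemma contains_231I: "subseq [b, c, a] w \<Longrightarrow> a < b \<Longrightarrow> b < c \<Longrightarrow> contains w [2, 3, 1]"
  using contains_231_iff by blast

lemma contains_213_iff: "contains w [2, 1, 3] \<longleftrightarrow> (\<exists>a b c. subseq [b, a, c] w \<and> a < b \<and> b < c)"
proof -
  have "same_order [b, a, c] [2, 1, 3] \<longleftrightarrow> a < b \<and> b < c" for a b c by auto
  then show ?thesis unfolding contains_triple_iff by metis
qed

lemma contains_231_Cons:
  "contains (x # w) [2, 3, 1] \<longleftrightarrow>
     contains w [2, 3, 1] \<or> (\<exists>a c. subseq [c, a] w \<and> a < x \<and> x < c)"
proof
  assume "contains (x # w) [2, 3, 1]"
  then obtain a b c where abc: "subseq [b, c, a] (x # w)" "a < b" "b < c"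
    unfolding contains_231_iff by blast
  from abc(1) show "contains w [2, 3, 1] \<or> (\<exists>a c. subseq [c, a] w \<and> a < x \<and> x < c)"
    by cases (use abc(2,3) contains_231_iff in blast)+
next
  assume "contains w [2, 3, 1] \<or> (\<exists>a c. subseq [c, a] w \<and> a < x \<and> x < c)"
  then show "contains (x # w) [2, 3, 1]"
  proof
    assume "\<exists>a c. subseq [c, a] w \<and> a < x \<and> x < c"
    then show ?thesis unfolding contains_231_iff by (meson subseq_Cons2)
  qed (auto elim: contains_subseq)
qed

lemma contains_231_Cons_min:
  assumes "\<forall>y\<in>set w. x \<le> y"
  shows "contains (x # w) [2, 3, 1] \<longleftrightarrow> contains w [2, 3, 1]"
  using assms set_subseq[of _ w] unfolding contains_231_Cons by fastforce

lemma contains_231_Cons_max: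
  assumes "\<forall>y\<in>set w. y \<le> x"
  shows "contains (x # w) [2, 3, 1] \<longleftrightarrow> contains w [2, 3, 1]"
  using assms set_subseq[of _ w] unfolding contains_231_Cons by fastforce

lemma contains_231_Cons_descent:
  assumes "y \<le> x"
  shows "contains (x # y # w) [2, 3, 1] \<longleftrightarrow>
    contains (x # w) [2, 3, 1] \<or> contains (y # w) [2, 3, 1]"
proof -
  have "subseq [c, a] (y # w) \<longleftrightarrow> subseq [c, a] w" if "x < c" for a c
    using that assms by simp
  then show ?thesis
    unfolding contains_231_Cons[of x] using contains_231_Cons[of y w] by blast
qed

lemma contains_231_Cons_Cons_min:
  assumes "m \<le> x" "\<forall>y\<in>set w. m \<le> y"
  shows "contains (x # m # w) [2, 3, 1] \<longleftrightarrow> contains (x # w) [2, 3, 1]"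
  unfolding contains_231_Cons_descent[OF assms(1)] contains_231_Cons_min[OF assms(2)]
  using contains_231_Cons by blast

lemma contains_231_snoc_min:
  assumes "\<forall>x\<in>set w. m < x"
  shows "contains (w @ [m]) [2, 3, 1] \<longleftrightarrow> \<not> sorted_wrt (\<ge>) w"
proof
  assume "contains (w @ [m]) [2, 3, 1]"
  then obtain a b c where abc: "subseq [b, c, a] (w @ [m])" "a < b" "b < c"
    unfolding contains_231_iff by blast
  have "m \<le> a" using assms set_subseq[OF abc(1)] by fastforce
  then have "c \<noteq> m" using abc(2,3) by simp
  moreover have "subseq [b, c] (w @ [m])"
    by (rule subseq_order.order_trans[OF _ abc(1)]) simp
  ultimately have "subseq [b, c] w"
    by (auto simp: subseq_append_iff Cons_eq_append_conv split: if_splits)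
  then show "\<not> sorted_wrt (\<ge>) w" using abc(3) unfolding sorted_wrt_iff_subseq by force
next
  assume "\<not> sorted_wrt (\<ge>) w"
  then obtain b c where bc: "subseq [b, c] w" "b < c" unfolding sorted_wrt_iff_subseq by force
  have "subseq [b, c, m] (w @ [m])" using list_emb_append_mono[OF bc(1), of "[m]" "[m]"] by simp
  moreover have "m < b" using assms set_subseq[OF bc(1)] by simp
  ultimately show "contains (w @ [m]) [2, 3, 1]" using bc(2) unfolding contains_231_iff by blast
qed

lemma contains_213_append_iff:
  "contains (us @ vs) [2, 1, 3] \<longleftrightarrow> contains us [2, 1, 3] \<or> contains vs [2, 1, 3] \<or>
     (\<exists>a b c. a < b \<and> b < c \<and>
       (subseq [b, a] us \<and> c \<in> set vs \<or> b \<in> set us \<and> subseq [a, c] vs))"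
proof -
  have "subseq [b, a, c] (us @ vs) \<longleftrightarrow> subseq [b, a, c] us \<or> subseq [b, a, c] vs \<or>
      subseq [b, a] us \<and> c \<in> set vs \<or> b \<in> set us \<and> subseq [a, c] vs" for a b c
    using list_emb_append_mono[of "(=)" "[b, a]" us "[c]" vs]
      list_emb_append_mono[of "(=)" "[b]" us "[a, c]" vs]
    by (auto simp: subseq_append_iff Cons_eq_append_conv subseq_singleton_left)
  then show ?thesis unfolding contains_213_iff by blast
qed

lemma contains_213_Cons_min:
  assumes "\<forall>y\<in>set w. x \<le> y"
  shows "contains (x # w) [2, 1, 3] \<longleftrightarrow> contains w [2, 1, 3]"
proof -
  have "subseq [b, a, c] w" if "subseq [b, a, c] (x # w)" "a < b" for a b c
    using that assms set_subseq[of "[a, c]" w] by (cases "b = x") auto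
  then show ?thesis unfolding contains_213_iff by (meson list_emb_Cons)
qed

lemma contains_213_append_min_iff:
  assumes "\<forall>x\<in>set us \<union> set vs. m < x"
  shows "contains (us @ m # vs) [2, 1, 3] \<longleftrightarrow>
    contains us [2, 1, 3] \<or> contains vs [2, 1, 3] \<or> (\<exists>u\<in>set us. \<exists>v\<in>set vs. u < v)"
proof -
  have tail: "contains (m # vs) [2, 1, 3] \<longleftrightarrow> contains vs [2, 1, 3]"
    using assms by (intro contains_213_Cons_min) (auto intro: less_imp_le)
  have "(\<exists>a b c. a < b \<and> b < c \<and>
      (subseq [b, a] us \<and> c \<in> set (m # vs) \<or> b \<in> set us \<and> subseq [a, c] (m # vs))) \<longleftrightarrow>
    (\<exists>u\<in>set us. \<exists>v\<in>set vs. u < v)" (is "?across \<longleftrightarrow> ?ascent")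
  proof
    assume ?across
    then obtain a b c where abc: "b < c"
        "subseq [b, a] us \<and> c \<in> set (m # vs) \<or> b \<in> set us \<and> subseq [a, c] (m # vs)"
      by blast
    then have "b \<in> set us" "c \<in> set (m # vs)"
      using set_subseq[of "[b, a]" us] set_subseq[of "[a, c]" "m # vs"] by auto
    moreover from this(1) have "m < c" using assms abc(1) by (meson UnI1 less_trans)
    ultimately show ?ascent using abc(1) by auto
  next
    assume ?ascent
    then obtain u v where uv: "u \<in> set us" "v \<in> set vs" "u < v" by blast
    then have "subseq [m, v] (m # vs)" "m < u" using assms by (simp_all add: subseq_singleton_left)
    then show ?across using uv by blast
  qed
  then show ?thesis unfolding contains_213_append_iff tail by blast
qed

lemma perm_class_Av: "perm_class (Av P)"
  unfolding perm_class_def Av_def using contains_trans by blast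

lemma contains_consec_cong:
  assumes "same_order xs ys"
  shows "contains_consec xs p \<longleftrightarrow> contains_consec ys p"
proof -
  have "contains_consec vs p" if so: "same_order us vs" and c: "contains_consec us p" for us vs
  proof -
    obtain f where f: "strict_mono_on (set us) f" "vs = map f us"
      using so by (auto simp: same_order_iff_map)
    obtain zs where zs: "sublist zs us" "same_order zs p"
      using c by (auto simp: contains_consec_def)
    have "same_order (map f zs) zs" using f(1) set_mono_sublist[OF zs(1)] by (rule same_order_map)
    then show ?thesis
      unfolding contains_consec_def f(2) using zs same_order_trans map_mono_sublist by blast
  qed
  then show ?thesis using assms same_order_sym by blast
qed

lemma contains_consec_imp_contains: "contains_consec xs p \<Longrightarrow> contains xs p"
  unfolding contains_consec_def contains_def by (meson sublist_imp_subseq)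

lemma contains_consec_Cons:
  "contains_consec (x # xs) p \<longleftrightarrow>
     same_order (take (length p) (x # xs)) p \<or> contains_consec xs p"
proof -
  have "(\<exists>zs. prefix zs (x # xs) \<and> same_order zs p) \<longleftrightarrow> same_order (take (length p) (x # xs)) p"
    by (metis append_eq_conv_conj prefix_def same_order_length take_is_prefix)
  then show ?thesis unfolding contains_consec_def sublist_Cons_right by blast
qed

lemma contains_consec_short: "length xs < length p \<Longrightarrow> \<not> contains_consec xs p"
  unfolding contains_consec_def by (metis leD same_order_length sublist_length_le)

section \<open>The stack procedure\<close>

text \<open>Since the stack avoids \<open>\<sigma>\<close> at all times, pushing an entry can only create an
  occurrence of \<open>\<sigma>\<close> at the very top.\<close>

definition blocked :: "nat list \<Rightarrow> nat \<Rightarrow> nat list \<Rightarrow> bool" where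
  "blocked \<sigma> x st \<longleftrightarrow> same_order (take (length \<sigma>) (x # st)) \<sigma>"

function sc_run :: "nat list \<Rightarrow> nat list \<Rightarrow> nat list \<Rightarrow> nat list" where
  "sc_run \<sigma> [] st = st"
| "sc_run \<sigma> (x # inp) [] = sc_run \<sigma> inp [x]"
| "sc_run \<sigma> (x # inp) (s # st) =
     (if blocked \<sigma> x (s # st) then s # sc_run \<sigma> (x # inp) st else sc_run \<sigma> inp (x # s # st))"
  by pat_completeness auto
termination
  by (relation "measure (\<lambda>(\<sigma>, inp, st). 2 * length inp + length st)") auto

lemma not_blocked_short: "length st + 1 < length \<sigma> \<Longrightarrow> \<not> blocked \<sigma> x st"
  unfolding blocked_def by (auto dest!: same_order_length)

lemma contains_consec_Cons_blocked:
  "contains_consec (x # st) \<sigma> \<longleftrightarrow> blocked \<sigma> x st \<or> contains_consec st \<sigma>"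
  by (simp only: contains_consec_Cons blocked_def)

lemma sc_run_push: "\<not> blocked \<sigma> x st \<Longrightarrow> sc_run \<sigma> (x # inp) st = sc_run \<sigma> inp (x # st)"
  by (cases st) auto

lemma sc_run_push_all:
  assumes "\<not> contains_consec (rev inp @ st) \<sigma>"
  shows "sc_run \<sigma> (inp @ rest) st = sc_run \<sigma> rest (rev inp @ st)"
  using assms
proof (induction inp arbitrary: st)
  case (Cons x inp)
  have "\<not> contains_consec (x # st) \<sigma>"
    using Cons.prems unfolding contains_consec_def
    by simp (meson sublist_append_leftI sublist_order.order_trans)
  then have "\<not> blocked \<sigma> x st" by (simp add: contains_consec_Cons_blocked)
  then show ?case using Cons by (simp add: sc_run_push)
qed simp

lemma mset_sc_run: "mset (sc_run \<sigma> inp st) = mset inp + mset st"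
  by (induction \<sigma> inp st rule: sc_run.induct) auto

lemma set_sc_run: "set (sc_run \<sigma> inp st) = set inp \<union> set st"
  using mset_sc_run[of \<sigma> inp st] by (metis set_mset_mset set_mset_union)

lemma subseq_sc_run: "subseq st (sc_run \<sigma> inp st)"
proof (induction \<sigma> inp st rule: sc_run.induct)
  case (3 \<sigma> x inp s st)
  then show ?case using subseq_Cons'[of x "s # st"] by auto
qed auto

lemma sc_run_map:
  assumes "strict_mono_on (set inp \<union> set st) f"
  shows "sc_run \<sigma> (map f inp) (map f st) = map f (sc_run \<sigma> inp st)"
  using assms
proof (induction \<sigma> inp st rule: sc_run.induct)
  case (3 \<sigma> x inp s st)
  have "set (take (length \<sigma>) (x # s # st)) \<subseteq> set (x # inp) \<union> set (s # st)"
    using set_take_subset[of "length \<sigma>" "x # s # st"] by auto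
  with "3.prems" have "same_order (map f (take (length \<sigma>) (x # s # st))) (take (length \<sigma>) (x # s # st))"
    by (rule same_order_map)
  then have "blocked \<sigma> (f x) (f s # map f st) \<longleftrightarrow> blocked \<sigma> x (s # st)"
    unfolding blocked_def same_order_def by (metis list.map take_map)
  moreover have "strict_mono_on (set (x # inp) \<union> set st) f"
      "strict_mono_on (set inp \<union> set (x # s # st)) f"
    using "3.prems" by (auto simp: strict_mono_on_def)
  ultimately show ?case using "3.IH" by auto
qed auto

lemma sc_run_same_order:
  assumes "same_order u v"
  shows "same_order (sc_run \<sigma> u []) (sc_run \<sigma> v [])"
proof -
  obtain f where f: "strict_mono_on (set u) f" "v = map f u"
    using assms by (auto simp: same_order_iff_map)
  then have "sc_run \<sigma> v [] = map f (sc_run \<sigma> u [])" using sc_run_map[of u "[]" f \<sigma>] by simp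
  then show ?thesis using f(1) by (auto simp: same_order_iff_map set_sc_run)
qed

abbreviation consec_avoiders :: "nat list \<Rightarrow> nat list set" where
  "consec_avoiders \<sigma> \<equiv> {\<tau> \<in> perms. \<not> contains_consec \<tau> \<sigma>}"

lemma ex_same_order_consec_avoider_iff:
  assumes "distinct w"
  shows "(\<exists>\<tau>\<in>consec_avoiders \<sigma>. same_order w \<tau>) \<longleftrightarrow> \<not> contains_consec w \<sigma>"
proof
  assume "\<not> contains_consec w \<sigma>"
  then have "\<not> contains_consec (standardize w) \<sigma>"
    using contains_consec_cong[OF same_order_standardize] by blast
  then show "\<exists>\<tau>\<in>consec_avoiders \<sigma>. same_order w \<tau>"
    using same_order_sym[OF same_order_standardize] standardize_in_perms[OF assms] by blast
qed (use contains_consec_cong in blast)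

lemma stack_run_consec_avoiders_Cons:
  assumes "distinct (x # st)"
  shows "stack_run (consec_avoiders \<sigma>) (x # inp) st =
    (if contains_consec (x # st) \<sigma>
     then (case st of [] \<Rightarrow> [] | s # st' \<Rightarrow> s # stack_run (consec_avoiders \<sigma>) (x # inp) st')
     else stack_run (consec_avoiders \<sigma>) inp (x # st))"
  by (subst stack_run.simps(3), subst ex_same_order_consec_avoider_iff[OF assms])
    (simp del: stack_run.simps)

lemma stack_run_consec_avoiders_eq_sc_run:
  assumes "2 \<le> length \<sigma>" "distinct (inp @ st)" "\<not> contains_consec st \<sigma>"
  shows "stack_run (consec_avoiders \<sigma>) inp st = sc_run \<sigma> inp st"
  using assms
proof (induction \<sigma> inp st rule: sc_run.induct)
  case (1 \<sigma> st)
  have "stack_run A [] st = st" for A by (induction st) auto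
  then show ?case by simp
next
  case (2 \<sigma> x inp)
  have "\<not> contains_consec [x] \<sigma>" using 2 by (intro contains_consec_short) auto
  then show ?case using 2 by (simp add: stack_run_consec_avoiders_Cons del: stack_run.simps)
next
  case (3 \<sigma> x inp s st)
  have "\<not> contains_consec st \<sigma>" using 3 by (simp add: contains_consec_Cons_blocked)
  moreover have "contains_consec (x # s # st) \<sigma> \<longleftrightarrow> blocked \<sigma> x (s # st)"
    using "3.prems"(3) by (subst contains_consec_Cons_blocked) simp
  ultimately show ?case using 3 by (simp add: stack_run_consec_avoiders_Cons del: stack_run.simps)
qed

lemma SC_eq_sc_run:
  assumes "2 \<le> length \<sigma>" "distinct \<pi>"
  shows "SC \<sigma> \<pi> = sc_run \<sigma> \<pi> []"
proof -
  have "\<not> contains_consec [] \<sigma>" using assms(1) by (cases \<sigma>) (simp_all add: contains_consec_short)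
  then show ?thesis
    unfolding SC_def T_def using assms by (simp add: stack_run_consec_avoiders_eq_sc_run)
qed

lemma SC_same_order: "same_order \<sigma> \<tau> \<Longrightarrow> SC \<sigma> = SC \<tau>"
  by (simp add: SC_def contains_consec_def same_order_def)

lemma sc_run_blocked_contains_swap:
  assumes "blocked (a # b # \<sigma>) x st"
  shows "contains (sc_run (a # b # \<sigma>) (x # inp) st) (b # a # \<sigma>)"
  using assms
proof (induction st)
  case Nil
  then show ?case by (simp add: blocked_def)
next
  case (Cons s st)
  show ?case
  proof (cases "blocked (a # b # \<sigma>) x st")
    case True
    then show ?thesis using Cons contains_subseq[of _ "b # a # \<sigma>" "s # _"] by auto
  next
    case False
    have "same_order (x # s # take (length \<sigma>) st) (a # b # \<sigma>)"
      using Cons.prems by (simp add: blocked_def)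
    then have "same_order (s # x # take (length \<sigma>) st) (b # a # \<sigma>)" by auto
    moreover have "subseq (x # take (length \<sigma>) st) (sc_run (a # b # \<sigma>) inp (x # st))"
      by (rule subseq_order.order_trans[OF _ subseq_sc_run])
        (simp add: prefix_imp_subseq take_is_prefix)
    then have "subseq (s # x # take (length \<sigma>) st) (sc_run (a # b # \<sigma>) (x # inp) (s # st))"
      using Cons.prems False by (simp add: sc_run_push)
    ultimately show ?thesis unfolding contains_def by blast
  qed
qed

lemma sc_run_contains_swap:
  assumes "contains_consec (rev inp @ st) (a # b # \<sigma>)" "\<not> contains_consec st (a # b # \<sigma>)"
  shows "contains (sc_run (a # b # \<sigma>) inp st) (b # a # \<sigma>)"
  using assms
proof (induction inp arbitrary: st)
  case (Cons x inp)
  show ?case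
  proof (cases "blocked (a # b # \<sigma>) x st")
    case True
    then show ?thesis by (rule sc_run_blocked_contains_swap)
  next
    case False
    then have "\<not> contains_consec (x # st) (a # b # \<sigma>)"
      using Cons.prems(2) by (simp add: contains_consec_Cons_blocked)
    then show ?thesis using Cons False by (simp add: sc_run_push)
  qed
qed simp

lemma sc_run_rev_pattern_append:
  assumes "same_order (x # y # zs) (a # b # \<sigma>)"
  shows "sc_run (a # b # \<sigma>) (rev (x # y # zs) @ inp) [] = y # sc_run (a # b # \<sigma>) inp (x # zs)"
proof -
  have len: "length zs = length \<sigma>" using same_order_length[OF assms] by simp
  have "\<not> contains_consec (y # zs) (a # b # \<sigma>)" by (rule contains_consec_short) (simp add: len)
  then have "sc_run (a # b # \<sigma>) (rev (y # zs) @ x # inp) [] =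
      sc_run (a # b # \<sigma>) (x # inp) (y # zs)"
    using sc_run_push_all[of "rev (y # zs)" "[]"] by simp
  moreover have "blocked (a # b # \<sigma>) x (y # zs)" using assms by (simp add: blocked_def len)
  moreover have "\<not> blocked (a # b # \<sigma>) x zs" by (rule not_blocked_short) (simp add: len)
  ultimately show ?thesis by (simp add: sc_run_push)
qed

section \<open>Sortable words\<close>

definition sortable :: "nat list \<Rightarrow> nat list \<Rightarrow> bool" where
  "sortable \<sigma> w \<longleftrightarrow> \<not> contains (sc_run \<sigma> w []) [2, 3, 1]"

lemma Sort_SC_iff_sortable:
  assumes "2 \<le> length \<sigma>"
  shows "\<pi> \<in> Sort (SC \<sigma>) \<longleftrightarrow> \<pi> \<in> perms \<and> sortable \<sigma> \<pi>"
proof (cases "\<pi> \<in> perms")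
  case True
  then have "SC \<sigma> \<pi> = sc_run \<sigma> \<pi> []" by (simp add: assms SC_eq_sc_run perms_distinct)
  moreover have "sc_run \<sigma> \<pi> [] \<in> perms"
    using True perms_mset_cong[of "sc_run \<sigma> \<pi> []" \<pi>] by (simp add: mset_sc_run)
  ultimately show ?thesis using True by (simp add: Sort_def Av_def sortable_def)
qed (simp add: Sort_def)

lemma sortable_same_order: "same_order u v \<Longrightarrow> sortable \<sigma> u \<longleftrightarrow> sortable \<sigma> v"
  unfolding sortable_def by (simp add: contains_cong sc_run_same_order)

lemma sortable_rev_iff:
  "\<not> contains_consec w \<sigma> \<Longrightarrow> sortable \<sigma> (rev w) \<longleftrightarrow> \<not> contains w [2, 3, 1]"
  using sc_run_push_all[of "rev w" "[]" \<sigma> "[]"] by (simp add: sortable_def)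

lemma sortable_rev_pattern_iff:
  "sortable (a # b # \<sigma>) (rev (a # b # \<sigma>)) \<longleftrightarrow> \<not> contains (b # a # \<sigma>) [2, 3, 1]"
  using sc_run_rev_pattern_append[of a b \<sigma> a b \<sigma> "[]"] by (simp add: sortable_def)

lemma sortable_rev_Cons_pattern_iff:
  assumes "same_order (x # y # zs) (a # b # \<sigma>)" and "(z < x) \<noteq> (a < b)"
  shows "sortable (a # b # \<sigma>) (rev (z # x # y # zs)) \<longleftrightarrow> \<not> contains (y # z # x # zs) [2, 3, 1]"
proof -
  have "\<not> blocked (a # b # \<sigma>) z (x # zs)" using assms(2) by (auto simp: blocked_def)
  then show ?thesis
    using sc_run_rev_pattern_append[OF assms(1), of "[z]"] by (simp add: sortable_def sc_run_push)
qed

lemma not_perm_class_Sort_SCI: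
  assumes \<sigma>: "2 \<le> length \<sigma>" and v: "distinct v" "sortable \<sigma> v"
    and u: "contains v u" "\<not> sortable \<sigma> u"
  shows "\<not> perm_class (Sort (SC \<sigma>))"
proof
  assume perm_class: "perm_class (Sort (SC \<sigma>))"
  have "standardize v \<in> Sort (SC \<sigma>)"
    using v sortable_same_order[OF same_order_standardize]
    by (simp add: Sort_SC_iff_sortable[OF \<sigma>] standardize_in_perms)
  moreover have "contains (standardize v) (standardize u)"
    using u(1) contains_cong[OF same_order_standardize same_order_standardize] by blast
  moreover have "standardize u \<in> perms"
    using contains_distinct[OF u(1) v(1)] by (rule standardize_in_perms)
  ultimately have "standardize u \<in> Sort (SC \<sigma>)"
    using perm_class by (auto simp: perm_class_def)
  then show False
    using u(2) sortable_same_order[OF same_order_standardize]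
    by (simp add: Sort_SC_iff_sortable[OF \<sigma>])
qed

section \<open>Patterns of length two\<close>

lemma blocked_ascent:
  assumes "p < q"
  shows "blocked [p, q] x (s # st) \<longleftrightarrow> x < s"
  using assms by (auto simp: blocked_def)

lemma sc_run_ascent_pop_all:
  assumes "p < q" "\<forall>y\<in>set st. m < y"
  shows "sc_run [p, q] (m # inp) st = st @ sc_run [p, q] inp [m]"
  using assms by (induction st) (auto simp: blocked_ascent)

lemma sc_run_ascent_snoc_min:
  assumes "p < q" "\<forall>y\<in>set inp. m < y"
  shows "sc_run [p, q] inp (st @ [m]) = sc_run [p, q] inp st @ [m]"
  using assms by (induction "[p, q]" inp st rule: sc_run.induct) (auto simp: blocked_ascent)

lemma sc_run_ascent_append_min:
  assumes "p < q" "\<forall>y\<in>set us \<union> set vs \<union> set st. m < y"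
  shows "sc_run [p, q] (us @ m # vs) st = sc_run [p, q] us st @ sc_run [p, q] vs [] @ [m]"
  using assms
proof (induction "[p, q]" us st rule: sc_run.induct)
  case (1 st)
  then show ?case
    using sc_run_ascent_pop_all[of p q st m vs] sc_run_ascent_snoc_min[of p q vs m "[]"] by simp
qed auto

lemma distinct_split_min:
  fixes xs :: "'a :: linorder list"
  assumes "distinct xs" "xs \<noteq> []"
  obtains us m vs where "xs = us @ m # vs" "\<forall>y\<in>set us \<union> set vs. m < y"
proof -
  obtain us vs where xs: "xs = us @ Min (set xs) # vs"
    using assms(2) by (meson List.finite_set Min_in set_empty split_list)
  moreover have "Min (set xs) < y" if "y \<in> set us \<union> set vs" for y
  proof -
    have "y \<in> set xs" using that by (subst xs) auto
    moreover have "Min (set xs) \<notin> set us \<union> set vs"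
      using assms(1) by (subst (asm) xs) auto
    ultimately show ?thesis using that by (metis List.finite_set Min_le order_le_neq_trans)
  qed
  ultimately show thesis using that by blast
qed

lemma sorted_wrt_sc_run_ascent_iff:
  assumes "p < q" "distinct w"
  shows "sorted_wrt (\<ge>) (sc_run [p, q] w []) \<longleftrightarrow> \<not> contains w [2, 1, 3]"
  using assms(2)
proof (induction w rule: length_induct)
  case (1 w)
  show ?case
  proof (cases "w = []")
    case False
    with \<open>distinct w\<close> obtain us m vs where w: "w = us @ m # vs" and m: "\<forall>y\<in>set us \<union> set vs. m < y"
      by (rule distinct_split_min)
    have IH: "sorted_wrt (\<ge>) (sc_run [p, q] us []) \<longleftrightarrow> \<not> contains us [2, 1, 3]"
      "sorted_wrt (\<ge>) (sc_run [p, q] vs []) \<longleftrightarrow> \<not> contains vs [2, 1, 3]"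
      using 1 by (auto simp: w)
    have "sc_run [p, q] w [] = sc_run [p, q] us [] @ sc_run [p, q] vs [] @ [m]"
      using m by (simp add: w sc_run_ascent_append_min[OF assms(1)])
    then have "sorted_wrt (\<ge>) (sc_run [p, q] w []) \<longleftrightarrow>
        sorted_wrt (\<ge>) (sc_run [p, q] us []) \<and> sorted_wrt (\<ge>) (sc_run [p, q] vs []) \<and>
        (\<forall>u\<in>set us. \<forall>v\<in>set vs. v \<le> u)"
      using m by (auto simp: sorted_wrt_append set_sc_run less_imp_le)
    then show ?thesis
      unfolding w contains_213_append_min_iff[OF m] IH by (simp add: not_less)
  qed simp
qed

lemma sortable_ascent_iff:
  assumes "p < q" "distinct w"
  shows "sortable [p, q] w \<longleftrightarrow> \<not> contains w [2, 1, 3]"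
proof (cases "w = []")
  case False
  with assms(2) obtain us m vs where w: "w = us @ m # vs" and m: "\<forall>y\<in>set us \<union> set vs. m < y"
    by (rule distinct_split_min)
  define out where "out = sc_run [p, q] us [] @ sc_run [p, q] vs []"
  have run: "sc_run [p, q] w [] = out @ [m]"
    using m by (simp add: w out_def sc_run_ascent_append_min[OF assms(1)])
  have m_less: "\<forall>y\<in>set out. m < y" using m by (auto simp: out_def set_sc_run)
  have "sortable [p, q] w \<longleftrightarrow> sorted_wrt (\<ge>) (out @ [m])"
    using m_less contains_231_snoc_min[OF m_less]
    by (auto simp: sortable_def run sorted_wrt_append less_imp_le)
  then show ?thesis using sorted_wrt_sc_run_ascent_iff[OF assms] run by simp
qed (simp add: sortable_def)

lemma Sort_SC_12: "Sort (SC [1, 2]) = Av {[2, 1, 3]}"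
  by (rule set_eqI)
    (use Sort_SC_iff_sortable[of "[1, 2]"] sortable_ascent_iff[of 1 2] perms_distinct
      in \<open>auto simp: Av_def\<close>)

lemma not_perm_class_Sort_SC_21: "\<not> perm_class (Sort (SC [2, 1]))"
proof (rule not_perm_class_Sort_SCI)
  have run: "sc_run [2, 1] [3, 5, 2, 4, 1] [] = [3, 2, 1, 4, 5]" by (simp add: blocked_def)
  show "sortable [2, 1] [3, 5, 2, 4, 1]"
    unfolding sortable_def run contains_231_iff by (auto split: if_splits)
  have run: "sc_run [2, 1] [3, 2, 4, 1] [] = [2, 3, 1, 4]" by (simp add: blocked_def)
  show "\<not> sortable [2, 1] [3, 2, 4, 1]"
    unfolding sortable_def run not_not by (rule subseq_imp_contains) simp
  show "contains [3, 5, 2, 4, 1] [3, 2, 4, 1]" by (rule subseq_imp_contains) simp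
qed auto

section \<open>Patterns of length at least three\<close>

lemma sortable_iff_avoids_132:
  assumes "contains (a # b # s) [2, 3, 1]" "contains (b # a # s) [2, 3, 1]"
  shows "sortable (a # b # s) w \<longleftrightarrow> \<not> contains w [1, 3, 2]"
proof (cases "contains_consec (rev w) (a # b # s)")
  case True
  then have "contains (rev w) [2, 3, 1]"
    using assms(1) contains_consec_imp_contains contains_trans by blast
  then have "contains w [1, 3, 2]" using contains_rev_132[of "rev w"] by simp
  moreover have "contains (sc_run (a # b # s) w []) (b # a # s)"
    using sc_run_contains_swap[of w "[]"] True by (simp add: contains_consec_short)
  ultimately show ?thesis using assms(2) contains_trans unfolding sortable_def by blast
next
  case False
  then show ?thesis using sortable_rev_iff[OF False] contains_rev_132[of "rev w"] by simp
qed

lemma Sort_SC_eq_Av_132: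
  assumes "contains (a # b # s) [2, 3, 1]" "contains (b # a # s) [2, 3, 1]"
  shows "Sort (SC (a # b # s)) = Av {[1, 3, 2]}"
  using Sort_SC_iff_sortable[of "a # b # s"] sortable_iff_avoids_132[OF assms]
  by (auto simp: Av_def)

lemma not_perm_class_Sort_SC_231: "\<not> perm_class (Sort (SC [2, 3, 1]))"
proof (rule not_perm_class_Sort_SCI)
  have run: "sc_run [2, 3, 1] [2, 5, 3, 1, 4] [] = [5, 4, 1, 3, 2]" by (simp add: blocked_def)
  show "sortable [2, 3, 1] [2, 5, 3, 1, 4]"
    unfolding sortable_def run contains_231_iff by (auto split: if_splits)
  have run: "sc_run [2, 3, 1] [2, 5, 1, 4] [] = [4, 1, 5, 2]" by (simp add: blocked_def)
  show "\<not> sortable [2, 3, 1] [2, 5, 1, 4]"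
    unfolding sortable_def run not_not by (rule contains_231I[of 4 5 2]) simp_all
  show "contains [2, 5, 3, 1, 4] [2, 5, 1, 4]" by (rule subseq_imp_contains) simp
qed auto

lemma not_sortable_132:
  assumes "3 \<le> length \<sigma>" "\<not> same_order [2, 3, 1] \<sigma>"
  shows "\<not> sortable \<sigma> [1, 3, 2]"
proof -
  have "\<not> contains_consec [3, 1] \<sigma>" using assms(1) by (intro contains_consec_short) simp
  then have "\<not> contains_consec [2, 3, 1] \<sigma>"
    using assms contains_consec_Cons[of 2 "[3, 1]" \<sigma>] by (simp del: same_order_Cons)
  then show ?thesis using sortable_rev_iff[of "[2, 3, 1]" \<sigma>] contains_refl by simp
qed

lemma not_perm_class_Sort_SC_if_sortable_rev_231:
  assumes "3 \<le> length \<sigma>" "\<not> same_order [2, 3, 1] \<sigma>"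
    and "distinct w" "contains w [2, 3, 1]" "sortable \<sigma> (rev w)"
  shows "\<not> perm_class (Sort (SC \<sigma>))"
proof (rule not_perm_class_Sort_SCI)
  show "contains (rev w) [1, 3, 2]" using assms(4) by (simp only: contains_rev_132)
qed (use assms not_sortable_132 in auto)

lemma not_perm_class_Sort_SC_swap_avoids:
  assumes "distinct (a # b # s)" "s \<noteq> []" "\<not> same_order [2, 3, 1] (a # b # s)"
    and "contains (a # b # s) [2, 3, 1]" "\<not> contains (b # a # s) [2, 3, 1]"
  shows "\<not> perm_class (Sort (SC (a # b # s)))"
proof (rule not_perm_class_Sort_SC_if_sortable_rev_231)
  show "sortable (a # b # s) (rev (a # b # s))"
    unfolding sortable_rev_pattern_iff by (rule assms(5))
  show "3 \<le> length (a # b # s)" using assms(2) by (cases s) auto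
qed (use assms in blast)+

lemma swap_contains_231E:
  assumes "\<not> contains (a # b # s) [2, 3, 1]" "contains (b # a # s) [2, 3, 1]"
  obtains p where "p \<in> set s" "p < b" "b < a"
proof -
  obtain p q r where pqr: "subseq [q, r, p] (b # a # s)" "p < q" "q < r"
    using assms(2) unfolding contains_231_iff by blast
  then have "\<not> subseq [q, r, p] (a # b # s)" using assms(1) unfolding contains_231_iff by blast
  then have "q = b \<and> r = a \<and> p \<in> set s"
    using pqr(1) by (auto split: if_splits simp: subseq_singleton_left dest: subseq_Cons')
  then show thesis using that pqr by blast
qed

text \<open>Here the first two entries of the pattern are descending above some later entry; inserting
  a new minimum between them destroys every consecutive occurrence and creates no 231.\<close>

lemma not_perm_class_Sort_SC_swap_contains:
  assumes "distinct (a # b # s)"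
    and avoids: "\<not> contains (a # b # s) [2, 3, 1]" and swap: "contains (b # a # s) [2, 3, 1]"
  shows "\<not> perm_class (Sort (SC (a # b # s)))"
proof (rule not_perm_class_Sort_SCI)
  let ?w = "Suc a # 0 # map Suc (b # s)"
  have shift: "same_order (map Suc (a # b # s)) (a # b # s)"
    by (rule same_order_map[of UNIV]) (auto simp: strict_mono_on_def)
  show "distinct (rev ?w)" using assms(1) by (auto simp: distinct_map)
  show "\<not> sortable (a # b # s) (rev (a # b # s))"
    unfolding sortable_rev_pattern_iff using swap by blast
  have "contains ?w (map Suc (a # b # s))" by (rule subseq_imp_contains) simp
  then have "contains ?w (a # b # s)" using contains_cong[OF same_order_refl shift] by blast
  then show "contains (rev ?w) (rev (a # b # s))" by (simp only: contains_rev)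
  obtain p where p: "p \<in> set s" "p < b" "b < a"
    using avoids swap by (rule swap_contains_231E)
  have "\<not> same_order (0 # us) (b # s)" for us
    using p(1,2) by (auto simp: list_all2_conv_all_nth in_set_conv_nth)
  then have "\<not> same_order (Suc a # 0 # us) (a # b # s)" for us
    unfolding same_order_Cons[of "Suc a"] by blast
  moreover have "\<not> same_order (0 # Suc b # us) (a # b # s)" for us using p(3) by auto
  moreover have "\<not> contains_consec (map Suc (b # s)) (a # b # s)"
    by (rule contains_consec_short) simp
  ultimately have no_consec: "\<not> contains_consec ?w (a # b # s)"
    by (simp add: contains_consec_Cons del: same_order_Cons)
  have "contains ?w [2, 3, 1] \<longleftrightarrow> contains (map Suc (a # b # s)) [2, 3, 1]"
    unfolding list.map(2)[of _ a] by (rule contains_231_Cons_Cons_min) auto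
  then have "\<not> contains ?w [2, 3, 1]"
    using avoids contains_cong[OF shift same_order_refl] by blast
  then show "sortable (a # b # s) (rev ?w)" using sortable_rev_iff[OF no_consec] by blast
qed auto

text \<open>Doubling all entries makes room for a new one right above or below \<open>2 * b\<close>. Arriving last, it
  precedes \<open>2 * b\<close> in the reversed input but follows it in the output, so its occurrence of 231 is
  lost.\<close>

lemma same_order_double: "same_order (map ((*) 2) xs) xs"
  by (rule same_order_map[of UNIV]) (auto simp: strict_mono_on_def)

lemma not_perm_class_Sort_SC_second_min:
  assumes "distinct (a # b # s)" "s \<noteq> []" "\<forall>x\<in>set (a # s). b < x"
    and avoids: "\<not> contains (a # b # s) [2, 3, 1]"
  shows "\<not> perm_class (Sort (SC (a # b # s)))"
proof (rule not_perm_class_Sort_SC_if_sortable_rev_231)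
  let ?w = "(2 * b + 1) # map ((*) 2) (a # b # s)"
  show "3 \<le> length (a # b # s)" using assms(2) by (cases s) auto
  show "\<not> same_order [2, 3, 1] (a # b # s)"
    using avoids same_order_imp_contains by blast
  show "distinct ?w"
    using assms(1) by (auto simp: distinct_map inj_on_def) presburger+
  have "subseq [2 * b + 1, 2 * a, 2 * b] ?w" by simp
  then show "contains ?w [2, 3, 1]" by (rule contains_231I) (use assms(3) in auto)
  have "\<forall>y\<in>set (map ((*) 2) (a # s)). 2 * b + 1 \<le> y" using assms(3) by fastforce
  then have "contains (2 * b # (2 * b + 1) # map ((*) 2) (a # s)) [2, 3, 1] \<longleftrightarrow>
      contains (map ((*) 2) (a # s)) [2, 3, 1]"
    using contains_231_Cons_min[of "(2 * b + 1) # map ((*) 2) (a # s)" "2 * b"]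
      contains_231_Cons_min[of "map ((*) 2) (a # s)" "2 * b + 1"] by force
  also have "\<dots> \<longleftrightarrow> contains (a # s) [2, 3, 1]"
    by (rule contains_cong[OF same_order_double same_order_refl])
  finally have "\<not> contains (2 * b # (2 * b + 1) # map ((*) 2) (a # s)) [2, 3, 1]"
    using avoids contains_subseq[of "a # s" _ "a # b # s"] by auto
  then show "sortable (a # b # s) (rev ?w)"
    using sortable_rev_Cons_pattern_iff[of "2 * a" "2 * b" "map ((*) 2) s" a b s "2 * b + 1"]
      same_order_double[of "a # b # s"] assms(3) by (auto simp del: same_order_Cons)
qed

lemma not_perm_class_Sort_SC_first_min:
  assumes "distinct (a # b # s)" "\<forall>x\<in>set (b # s). a < x" and x: "x \<in> set s" "x < b"
    and avoids: "\<not> contains (a # b # s) [2, 3, 1]" and swap: "\<not> contains (b # a # s) [2, 3, 1]"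
  shows "\<not> perm_class (Sort (SC (a # b # s)))"
proof (rule not_perm_class_Sort_SC_if_sortable_rev_231)
  let ?w = "(2 * b - 1) # map ((*) 2) (a # b # s)"
  have "0 < b" using x(2) by simp
  show "3 \<le> length (a # b # s)" using x(1) by (cases s) auto
  show "\<not> same_order [2, 3, 1] (a # b # s)"
    using avoids same_order_imp_contains by blast
  have "2 * b - 1 \<noteq> 2 * y" for y using \<open>0 < b\<close> by presburger
  then show "distinct ?w" using assms(1) by (auto simp: distinct_map inj_on_def)
  have "subseq [2 * b - 1, 2 * b, 2 * x] ?w" using x(1) by (simp add: subseq_singleton_left)
  then show "contains ?w [2, 3, 1]" by (rule contains_231I) (use x(2) in auto)
  have "2 * b - 1 < y \<longleftrightarrow> 2 * b < y" "y < 2 * b - 1 \<longleftrightarrow> y < 2 * b"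
    if "y \<in> set (map ((*) 2) (a # s))" for y
  proof -
    obtain z where "y = 2 * z" "z \<noteq> b" using \<open>y \<in> _\<close> assms(1) by auto
    then show "2 * b - 1 < y \<longleftrightarrow> 2 * b < y" "y < 2 * b - 1 \<longleftrightarrow> y < 2 * b"
      using \<open>0 < b\<close> by presburger+
  qed
  then have "same_order ((2 * b - 1) # map ((*) 2) (a # s)) (map ((*) 2) (b # a # s))"
    unfolding list.map(2)[of _ b] same_order_Cons
    by (blast intro: list.rel_refl_strong same_order_refl)
  then have "contains ((2 * b - 1) # map ((*) 2) (a # s)) [2, 3, 1] \<longleftrightarrow>
      contains (map ((*) 2) (b # a # s)) [2, 3, 1]"
    by (rule contains_cong) (rule same_order_refl)
  then have "contains (2 * b # (2 * b - 1) # map ((*) 2) (a # s)) [2, 3, 1] \<longleftrightarrow>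
      contains (map ((*) 2) (b # a # s)) [2, 3, 1]"
    using contains_231_Cons_descent[of "2 * b - 1" "2 * b"] by simp
  then have "\<not> contains (2 * b # (2 * b - 1) # map ((*) 2) (a # s)) [2, 3, 1]"
    using swap contains_cong[OF same_order_double same_order_refl] by blast
  then show "sortable (a # b # s) (rev ?w)"
    using sortable_rev_Cons_pattern_iff[of "2 * a" "2 * b" "map ((*) 2) s" a b s "2 * b - 1"]
      same_order_double[of "a # b # s"] assms(2) by (auto simp del: same_order_Cons)
qed

text \<open>Arriving after the reverse of \<open>\<sigma>\<close>, a new maximum leaves the stack between \<open>b\<close> and \<open>a\<close> and
  completes a 231. A second one inserted between \<open>a\<close> and \<open>b\<close> destroys the occurrence of \<open>\<sigma>\<close>.\<close>

lemma not_perm_class_Sort_SC_two_smallest_first: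
  assumes "distinct (a # b # s)" "s \<noteq> []" "a < b" "\<forall>x\<in>set s. b < x"
    and avoids: "\<not> contains (a # b # s) [2, 3, 1]"
  shows "\<not> perm_class (Sort (SC (a # b # s)))"
proof -
  obtain M where M: "\<forall>x\<in>set (a # b # s). x < M" using finite_nat_set_iff_bounded by blast
  let ?u = "M # a # b # s" and ?v = "Suc M # a # M # b # s"
  show ?thesis
  proof (rule not_perm_class_Sort_SCI)
    show "distinct (rev ?v)" using assms(1) M by auto
    have "subseq (Suc M # a # b # s) ?v" by auto
    moreover have "same_order (Suc M # a # b # s) ?u" using M by (auto simp: list_all2_same)
    ultimately have "contains ?v ?u" unfolding contains_def by blast
    then show "contains (rev ?v) (rev ?u)" by (simp only: contains_rev)
    have "subseq [b, M, a] (b # M # a # s)" by simp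
    then have "contains (b # M # a # s) [2, 3, 1]"
      by (rule contains_231I) (use assms(3) M in auto)
    then show "\<not> sortable (a # b # s) (rev ?u)"
      using sortable_rev_Cons_pattern_iff[of a b s a b s M] assms(3) M by auto
    have "\<not> same_order (Suc M # a # us) (a # b # s)" "\<not> same_order (M # b # us) (a # b # s)" for us
      using assms(3) M by auto
    moreover have "\<not> same_order (a # M # b # us) (a # b # s)" for us
      using assms(2,4) M by (cases s) auto
    moreover have "\<not> contains_consec (b # s) (a # b # s)" by (rule contains_consec_short) simp
    ultimately have no_consec: "\<not> contains_consec ?v (a # b # s)"
      using assms(2) by (cases s) (simp_all add: contains_consec_Cons del: same_order_Cons)
    have "contains ?v [2, 3, 1] \<longleftrightarrow> contains (a # M # b # s) [2, 3, 1]"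
      using M by (intro contains_231_Cons_max) auto
    also have "\<dots> \<longleftrightarrow> contains (M # b # s) [2, 3, 1]"
      using assms(3,4) M by (intro contains_231_Cons_min) auto
    also have "\<dots> \<longleftrightarrow> contains (b # s) [2, 3, 1]"
      using M by (intro contains_231_Cons_max) auto
    finally have "\<not> contains ?v [2, 3, 1]" using avoids contains_231_Cons by blast
    then show "sortable (a # b # s) (rev ?v)" using sortable_rev_iff[OF no_consec] by blast
  qed simp
qed

lemma not_perm_class_Sort_SC_both_avoid:
  assumes "distinct (a # b # s)" "s \<noteq> []"
    and avoids: "\<not> contains (a # b # s) [2, 3, 1]" "\<not> contains (b # a # s) [2, 3, 1]"
  shows "\<not> perm_class (Sort (SC (a # b # s)))"
proof -
  have min_less: "min a b < x" if x: "x \<in> set s" for x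
  proof (rule ccontr)
    assume "\<not> min a b < x"
    moreover have "x \<noteq> a" "x \<noteq> b" using assms(1) x by auto
    ultimately have less: "x < a" "x < b" by auto
    have "subseq [a, b, x] (a # b # s)" "subseq [b, a, x] (b # a # s)"
      using x by (auto simp: subseq_singleton_left)
    moreover have "a < b \<or> b < a" using assms(1) by auto
    ultimately show False using avoids less unfolding contains_231_iff by blast
  qed
  have "a \<noteq> b" "b \<notin> set s" using assms(1) by auto
  then consider "b < a" | x where "a < b" "x \<in> set s" "x < b" | "a < b" "\<forall>x\<in>set s. b < x"
    by (metis nat_neq_iff)
  then show ?thesis
  proof cases
    case 1
    then show ?thesis
      using not_perm_class_Sort_SC_second_min assms min_less by auto
  next
    case 2
    then show ?thesis
      using not_perm_class_Sort_SC_first_min assms min_less by auto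
  next
    case 3
    then show ?thesis using not_perm_class_Sort_SC_two_smallest_first assms by blast
  qed
qed

lemma perm_class_Sort_SC_iff:
  assumes "distinct (a # b # s)" "s \<noteq> []"
  shows "perm_class (Sort (SC (a # b # s))) \<longleftrightarrow>
    contains (a # b # s) [2, 3, 1] \<and> contains (b # a # s) [2, 3, 1]"
proof
  assume "contains (a # b # s) [2, 3, 1] \<and> contains (b # a # s) [2, 3, 1]"
  then show "perm_class (Sort (SC (a # b # s)))" using Sort_SC_eq_Av_132 perm_class_Av by simp
next
  assume perm_class: "perm_class (Sort (SC (a # b # s)))"
  then have "\<not> same_order [2, 3, 1] (a # b # s)"
    using SC_same_order not_perm_class_Sort_SC_231 by metis
  with perm_class show "contains (a # b # s) [2, 3, 1] \<and> contains (b # a # s) [2, 3, 1]"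
    using assms not_perm_class_Sort_SC_swap_avoids not_perm_class_Sort_SC_swap_contains
      not_perm_class_Sort_SC_both_avoid by blast
qed

theorem theorem2p2:
  shows "Sort (SC [1, 2]) = Av {[2, 1, 3]} \<and> perm_class (Av {[2, 1, 3]})
    \<and> \<not> perm_class (Sort (SC [2, 1]))
    \<and> (\<forall>k \<sigma>. 3 \<le> k \<longrightarrow> \<sigma> \<in> Sym k \<longrightarrow>
         (perm_class (Sort (SC \<sigma>)) \<longleftrightarrow>
            contains \<sigma> [2, 3, 1] \<and> contains (swap_first_two \<sigma>) [2, 3, 1])
       \<and> (contains \<sigma> [2, 3, 1] \<and> contains (swap_first_two \<sigma>) [2, 3, 1] \<longrightarrow>
            Sort (SC \<sigma>) = Av {[1, 3, 2]}))"
proof (intro conjI[OF Sort_SC_12] conjI[OF perm_class_Av] conjI[OF not_perm_class_Sort_SC_21]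
    allI impI)
  fix k \<sigma> assume "3 \<le> (k::nat)" and \<sigma>: "\<sigma> \<in> Sym k"
  then obtain a b c s where eq: "\<sigma> = a # b # c # s"
    using Sym_D(2)[OF \<sigma>] by (auto simp: numeral_3_eq_3 Suc_le_length_iff)
  show "(perm_class (Sort (SC \<sigma>)) \<longleftrightarrow>
        contains \<sigma> [2, 3, 1] \<and> contains (swap_first_two \<sigma>) [2, 3, 1])
      \<and> (contains \<sigma> [2, 3, 1] \<and> contains (swap_first_two \<sigma>) [2, 3, 1] \<longrightarrow>
        Sort (SC \<sigma>) = Av {[1, 3, 2]})"
    using perm_class_Sort_SC_iff[of a b "c # s"] Sort_SC_eq_Av_132[of a b "c # s"] Sym_D(1)[OF \<sigma>]
    unfolding eq swap_first_two.simps by blast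
qed

end
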